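(* Let $\alpha>0$, let $a_\theta>0$ be a constant, and let $\beta_\theta:(0,\infty)\to(0,\infty)$ be a continuous function such that, for some constants $c_\infty,c_0>0$, $$\lim_{z\to+\infty} z\,\beta_\theta(z)=c_\infty,\qquad \lim_{z\to 0^+} z\,\beta_\theta(z)=c_0 .$$ Consider the VAE with latent prior $p_\alpha(z_{rad})=f_{\mathrm{Inv}\Gamma}(z_{rad};\alpha,1)$ and decoder $p_\theta(r\mid z_{rad})=f_{\Gamma}(r;\alpha_\theta(z_{rad}),\beta_\theta(z_{rad}))$ with $\alpha_\theta(\cdot)\equiv a_\theta$, and let $R$ be its univariate output, i.e. the random variable with density $p(r)=\int_0^{+\infty}p_\theta(r\mid z_{rad})\,p_\alpha(z_{rad})\,dz_{rad}$ for $r>0$. Then the distribution of $R$ is heavy-tailed with tail index equal to $\alpha$.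
   Context: $f_{\mathrm{Inv}\Gamma}(z;\alpha,\beta)=\frac{\beta^\alpha}{\Gamma(\alpha)}z^{-\alpha-1}e^{-\beta/z}$, $z>0$, is the inverse-gamma density, and $f_\Gamma(r;a,b)=\frac{b^a}{\Gamma(a)}r^{a-1}e^{-br}$, $r>0$, is the Gamma density with shape $a>0$ and rate $b>0$. A VAE samples its output by first drawing a latent variable from the prior and then drawing the output from the decoder conditionally on the latent variable. (The parameterization also has an encoder $q_\phi(z_{rad}\mid r)=f_{\mathrm{Inv}\Gamma}(z_{rad};\alpha_\phi(r),\beta_\phi(r))$, which does not enter the law of the sampled output.) A random variable $R$ is heavy-tailed with tail index $\alpha>0$ if it is regularly varying with index $\alpha$: $\lim_{t\to+\infty}P(R>tx\mid R>t)=x^{-\alpha}$ for all $x\ge 1$. *)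

theory Defs
  imports "HOL-Probability.Probability"
begin

(* Shape a, rate b; extended by 0 outside the support (0, oo). *)
definition gamma_density :: "real \<Rightarrow> real \<Rightarrow> real \<Rightarrow> real" where
  "gamma_density a b r =
     (if r > 0 then b powr a / Gamma a * r powr (a - 1) * exp (- b * r) else 0)"

(* Extended by 0 outside the support (0, oo). *)
definition inv_gamma_density :: "real \<Rightarrow> real \<Rightarrow> real \<Rightarrow> real" where
  "inv_gamma_density \<alpha> \<beta> z =
     (if z > 0 then \<beta> powr \<alpha> / Gamma \<alpha> * z powr (- \<alpha> - 1) * exp (- \<beta> / z) else 0)"

(* Marginal density of the output of a VAE whose latent variable lives on (0, oo):
   "prior" is the latent density and "decoder z" the conditional density of the output
   given the latent value z.  The encoder does not enter the law of the output. *)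
definition vae_output_density :: "(real \<Rightarrow> real) \<Rightarrow> (real \<Rightarrow> real \<Rightarrow> real) \<Rightarrow> real \<Rightarrow> ennreal" where
  "vae_output_density prior decoder r =
     (\<integral>\<^sup>+ z\<in>{0<..}. ennreal (decoder z r * prior z) \<partial>lborel)"

(* A conditional probability given a null event is 0 under the library's convention.
   The case x = 1 therefore forces P(R > t) > 0 for all large t, hence for all t. *)
definition heavy_tailed :: "'a measure \<Rightarrow> ('a \<Rightarrow> real) \<Rightarrow> real \<Rightarrow> bool" where
  "heavy_tailed M R \<alpha> \<longleftrightarrow>
     prob_space M \<and> R \<in> borel_measurable M \<and> \<alpha> > 0 \<and>
     (\<forall>x\<ge>1. ((\<lambda>t. \<P>(\<omega> in M. R \<omega> > t * x \<bar> R \<omega> > t)) \<longlongrightarrow> x powr (- \<alpha>)) at_top)"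

end

(* Put k z = z * beta z, which is bounded between positive constants. Substituting z = r w turns
   r powr (alpha + 1) times the output density at r into an integral over w of an inverse-gamma
   kernel of shape a + alpha and scale k (r w), up to the factor exp (- 1 / (r w)). Dominated
   convergence gives a limit K > 0, so the density is asymptotic to K * r powr (- alpha - 1).
   Substituting r = t s in P(R > t) and using dominated convergence again gives
   P(R > t) ~ (K / alpha) * t powr (- alpha). *)
theory Submission
  imports Defs
begin

section \<open>Integrability and boundedness estimates that feed dominated convergence\<close>

lemma has_bochner_integral_powr_tail:
  fixes p :: real
  assumes "p > 0"
  shows "has_bochner_integral lborel (\<lambda>x. indicator {1<..} x * x powr (- p - 1)) (1 / p)"
proof (rule has_bochner_integral_nn_integral)
  have "(\<integral>\<^sup>+x. ennreal (indicator {1<..} x * x powr (- p - 1)) \<partial>lborel)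
      = (\<integral>\<^sup>+x. ennreal (x powr (- p - 1)) * indicator {1..} x \<partial>lborel)"
    \<comment> \<open>The fundamental theorem is applied on the closed half-line; adding the
      endpoint 1 changes the integrand only on a null set.\<close>
    using AE_lborel_singleton[of 1]
    by (intro nn_integral_cong_AE) (auto elim!: eventually_mono simp: indicator_def)
  also have "\<dots> = ennreal (0 - (- (1 powr (- p)) / p))"
  proof (rule nn_integral_FTC_atLeast)
    show "DERIV (\<lambda>x. - (x powr (- p)) / p) x :> x powr (- p - 1)" if "1 \<le> x" for x
      using assms that by (auto intro!: derivative_eq_intros simp: field_simps powr_diff)
    have "((\<lambda>x::real. x powr (- p)) \<longlongrightarrow> 0) at_top"
      using assms by (intro tendsto_neg_powr filterlim_ident) auto
    then show "((\<lambda>x::real. - (x powr (- p)) / p) \<longlongrightarrow> 0) at_top"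
      using tendsto_divide[OF tendsto_minus tendsto_const[of p]] assms by fastforce
  qed auto
  finally show "(\<integral>\<^sup>+x. ennreal (indicator {1<..} x * x powr (- p - 1)) \<partial>lborel) = ennreal (1 / p)"
    by simp
qed (use assms in \<open>auto simp: indicator_def\<close>)

text \<open>The right-hand side is the maximum over u, attained at \<open>u = q / m\<close>. It
  comes from \<open>ln x \<le> x - 1\<close> at \<open>x = m * u / q\<close>, multiplied by q and
  exponentiated.\<close>

lemma powr_mult_exp_neg_le:
  fixes q m u :: real
  assumes "q > 0" "m > 0" "u > 0"
  shows "u powr q * exp (- m * u) \<le> exp (q * ln (q / m) - q)"
proof -
  have "ln (m * u / q) \<le> m * u / q - 1"
    using assms by (intro ln_le_minus_one) auto
  then have "q * ln (m * u / q) \<le> q * (m * u / q - 1)"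
    using assms by (intro mult_left_mono) auto
  then have "q * ln u - m * u \<le> q * ln (q / m) - q"
    using assms by (simp add: ln_mult ln_div algebra_simps)
  moreover have "u powr q * exp (- m * u) = exp (q * ln u - m * u)"
    using assms by (simp add: powr_def exp_diff exp_minus field_simps)
  ultimately show ?thesis by simp
qed

text \<open>Near 0 the factor \<open>exp (- m / w)\<close> beats the negative power, so the kernel
  is bounded on \<open>{0<..1}\<close>; beyond 1 the exponential is at most 1 and the power tail is
  integrable.\<close>

lemma integrable_inv_gamma_kernel:
  fixes p m :: real
  assumes "p > 0" "m > 0"
  shows "integrable lborel (\<lambda>w. indicator {0<..} w * (w powr (- p - 1) * exp (- m / w)))"
proof (rule Bochner_Integration.integrable_bound)
  \<comment> \<open>The uniform bound of \<open>powr_mult_exp_neg_le\<close> for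
    \<open>q = p + 1\<close>, used at \<open>u = 1 / w\<close>.\<close>
  define D where "D = exp ((p + 1) * ln ((p + 1) / m) - (p + 1))"
  show "integrable lborel (\<lambda>w. D * indicator {0<..1} w + indicator {1<..} w * w powr (- p - 1))"
    using has_bochner_integral_powr_tail[OF assms(1)]
    by (intro Bochner_Integration.integrable_add integrable_mult_right integrable_real_indicator)
       (auto simp: has_bochner_integral_iff)
  have "norm (indicator {0<..} w * (w powr (- p - 1) * exp (- m / w)))
      \<le> norm (D * indicator {0<..1} w + indicator {1<..} w * w powr (- p - 1))" for w
  proof -
    consider "w \<le> 0" | "0 < w" "w \<le> 1" | "1 < w" by linarith
    then show ?thesis
    proof cases
      case 2
      have "(1 / w) powr (p + 1) * exp (- m * (1 / w)) \<le> D"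
        unfolding D_def using assms 2 by (intro powr_mult_exp_neg_le) auto
      moreover have "(1 / w) powr (p + 1) = w powr (- p - 1)"
        using 2 by (simp add: powr_divide powr_minus_divide[symmetric])
      ultimately show ?thesis using 2 by simp
    next
      case 3
      then show ?thesis using assms by (simp add: mult_left_le)
    qed simp
  qed
  then show "AE w in lborel. norm (indicator {0<..} w * (w powr (- p - 1) * exp (- m / w)))
      \<le> norm (D * indicator {0<..1} w + indicator {1<..} w * w powr (- p - 1))"
    by simp
qed simp

text \<open>The positive limits control g near both ends of the half-line, and on the compact
  interval left between them g attains a positive minimum and a maximum.\<close>

lemma continuous_pos_limits_bounded:
  fixes g :: "real \<Rightarrow> real"
  assumes cont: "continuous_on {0<..} g" and pos: "\<And>z. z > 0 \<Longrightarrow> g z > 0"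
    and "c > 0" "d > 0"
    and lim_top: "(g \<longlongrightarrow> c) at_top" and lim_0: "(g \<longlongrightarrow> d) (at_right 0)"
  obtains m B where "m > 0" "\<And>z. z > 0 \<Longrightarrow> m \<le> g z" "\<And>z. z > 0 \<Longrightarrow> g z \<le> B"
proof -
  have "\<forall>\<^sub>F z in at_top. c / 2 < g z \<and> g z < 2 * c"
    using order_tendstoD(1)[OF lim_top, of "c / 2"] order_tendstoD(2)[OF lim_top, of "2 * c"] \<open>c > 0\<close>
    by (intro eventually_conj) simp_all
  then obtain N where N: "\<And>z. z \<ge> N \<Longrightarrow> c / 2 < g z \<and> g z < 2 * c"
    by (auto simp: eventually_at_top_linorder)
  have "\<forall>\<^sub>F z in at_right 0. d / 2 < g z \<and> g z < 2 * d"
    using order_tendstoD(1)[OF lim_0, of "d / 2"] order_tendstoD(2)[OF lim_0, of "2 * d"] \<open>d > 0\<close>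
    by (intro eventually_conj) simp_all
  then obtain e where e: "e > 0" "\<And>z. 0 < z \<Longrightarrow> z < e \<Longrightarrow> d / 2 < g z \<and> g z < 2 * d"
    by (auto simp: eventually_at_right_field)
  \<comment> \<open>Taking \<open>max e N\<close> as right end keeps the interval nonempty when
    \<open>N < e\<close>.\<close>
  define I where "I = {e..max e N}"
  have I: "compact I" "I \<noteq> {}" "continuous_on I g"
    using e(1) by (auto simp: I_def intro: continuous_on_subset[OF cont])
  obtain x where x: "x \<in> I" "\<And>z. z \<in> I \<Longrightarrow> g x \<le> g z"
    using continuous_attains_inf[OF I] by blast
  obtain y where y: "y \<in> I" "\<And>z. z \<in> I \<Longrightarrow> g z \<le> g y"
    using continuous_attains_sup[OF I] by blast
  have cases: "z \<ge> N \<or> z < e \<or> z \<in> I" for z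
    by (auto simp: I_def)
  show thesis
  proof
    show "min (g x) (min (c / 2) (d / 2)) > 0"
      using x(1) e(1) pos \<open>c > 0\<close> \<open>d > 0\<close> by (auto simp: I_def)
    fix z :: real assume "z > 0"
    then show "min (g x) (min (c / 2) (d / 2)) \<le> g z" "g z \<le> max (g y) (max (2 * c) (2 * d))"
      using cases[of z] N[of z] e(2)[of z] x(2)[of z] y(2)[of z]
      by (auto simp: min_le_iff_disj le_max_iff_disj)
  qed
qed

section \<open>From a power-law density to regular variation of the tail\<close>

text \<open>The pure power case of the direct half of Karamata's theorem. The constant
  \<open>K / \<alpha>\<close> of the tail is positive and cancels in the conditional
  probability.\<close>

lemma heavy_tailed_of_density_asymptotic:
  fixes p :: "real \<Rightarrow> ennreal"
  assumes "prob_space M" and dist: "distributed M lborel R p" and "\<alpha> > 0" "K > 0"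
    and fin: "\<forall>\<^sub>F r in at_top. p r < \<top>"
    and lim: "((\<lambda>r. r powr (\<alpha> + 1) * enn2real (p r)) \<longlongrightarrow> K) at_top"
  shows "heavy_tailed M R \<alpha>"
proof -
  interpret prob_space M by fact
  have [measurable]: "p \<in> borel_measurable borel" "R \<in> borel_measurable M"
    using distributed_borel_measurable[OF dist] distributed_measurable[OF dist] by simp_all
  define h where "h r = r powr (\<alpha> + 1) * enn2real (p r)" for r
  have h_nonneg: "0 \<le> h r" for r by (simp add: h_def)
  have [measurable]: "h \<in> borel_measurable borel" unfolding h_def by measurable
  define P where "P t = \<P>(\<omega> in M. R \<omega> > t)" for t
  \<comment> \<open>After r = t s, extracting \<open>t powr (- \<alpha>)\<close> from the tail
    integral leaves the integrand \<open>k t s\<close>. \<open>D\<close> dominates it once h stays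
    below \<open>K + 1\<close>, the limit plus an arbitrary margin.\<close>
  define k where "k t s = indicator {1<..} s * (s powr (- \<alpha> - 1) * h (t * s))" for t s :: real
  define D where "D s = (K + 1) * (indicator {1<..} s * s powr (- \<alpha> - 1))" for s :: real
  have k_nonneg: "0 \<le> k t s" for t s using h_nonneg by (simp add: k_def)
  have [measurable]: "k t \<in> borel_measurable borel" for t unfolding k_def by measurable
  note tail = has_bochner_integral_powr_tail[OF \<open>\<alpha> > 0\<close>]
  have int_D: "integrable lborel D"
    using tail unfolding D_def by (auto simp: has_bochner_integral_iff)
  have "\<forall>\<^sub>F r in at_top. p r < \<top> \<and> h r < K + 1 \<and> r > 0"
    using fin order_tendstoD(2)[OF lim, of "K + 1"] eventually_gt_at_top[of 0]
    by (auto simp: h_def elim: eventually_elim2 intro!: eventually_conj)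
  then obtain t0 where t0: "\<And>r. r \<ge> t0 \<Longrightarrow> p r < \<top> \<and> h r < K + 1 \<and> r > 0"
    by (auto simp: eventually_at_top_linorder)
  have bound: "norm (k t s) \<le> D s" if "t \<ge> t0" for t s
  proof (cases "s > 1")
    case True
    have "t > 0" using t0[OF that] by simp
    then have "t0 \<le> t * s" using that True by (smt (verit) mult_le_cancel_left1)
    from t0[OF this] True h_nonneg[of "t * s"] show ?thesis
      by (auto simp: k_def D_def abs_mult mult.commute intro!: mult_right_mono)
  qed (simp add: k_def D_def)
  have "t powr \<alpha> * P t = (\<integral>s. k t s \<partial>lborel)" if t: "t \<ge> t0" for t
  proof -
    have "t > 0" using t0[OF t] by simp
    have int_k: "integrable lborel (k t)"
      using bound[OF t] by (intro Bochner_Integration.integrable_bound[OF int_D])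
        (auto intro!: AE_I2 order_trans[OF _ abs_ge_self])
    have "ennreal (P t) = (\<integral>\<^sup>+r. p r * indicator {t<..} r \<partial>lborel)"
      unfolding P_def using distributed_emeasure[OF dist, of "{t<..}"]
      by (simp add: emeasure_eq_measure vimage_def Int_def conj_commute)
    \<comment> \<open>The substitution r = t s turns the range r > t into s > 1, which no longer
      depends on t.\<close>
    also have "\<dots> = ennreal t * (\<integral>\<^sup>+s. p (0 + t * s) * indicator {t<..} (0 + t * s) \<partial>lborel)"
      using \<open>t > 0\<close> by (subst nn_integral_real_affine[where c = t and t = 0]) auto
    also have "\<dots> = (\<integral>\<^sup>+s. ennreal t * (p (t * s) * indicator {t<..} (t * s)) \<partial>lborel)"
      by (simp add: nn_integral_cmult)
    also have "\<dots> = (\<integral>\<^sup>+s. ennreal (t powr (- \<alpha>) * k t s) \<partial>lborel)"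
    proof (intro nn_integral_cong)
      fix s :: real
      show "ennreal t * (p (t * s) * indicator {t<..} (t * s)) = ennreal (t powr (- \<alpha>) * k t s)"
      proof (cases "s > 1")
        case True
        then have "t < t * s" using \<open>t > 0\<close> by simp
        \<comment> \<open>\<open>enn2real\<close> sends infinity to 0, so the round trip needs
          \<open>p\<close> finite at this point, which holds because \<open>t * s\<close> lies
          beyond \<open>t0\<close>.\<close>
        then have "ennreal (enn2real (p (t * s))) = p (t * s)"
          using t0[of "t * s"] t by simp
        moreover have "t powr (- \<alpha>) * k t s = t * enn2real (p (t * s))"
        proof -
          \<comment> \<open>The powers of t leave exactly the Jacobian t, and the powers of s
            cancel.\<close>
          have "t powr (- \<alpha>) * t powr (\<alpha> + 1) = t" "s powr (- \<alpha> - 1) * s powr (\<alpha> + 1) = 1"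
            using \<open>t > 0\<close> True by (simp_all flip: powr_add)
          moreover have "t powr (- \<alpha>) * k t s = (t powr (- \<alpha>) * t powr (\<alpha> + 1)) *
              (s powr (- \<alpha> - 1) * s powr (\<alpha> + 1)) * enn2real (p (t * s))"
            using \<open>t > 0\<close> True by (simp add: k_def h_def powr_mult)
          ultimately show ?thesis by simp
        qed
        ultimately show ?thesis
          using \<open>t < t * s\<close> \<open>t > 0\<close> by (simp add: ennreal_mult')
      next
        case False
        then have "\<not> t < t * s" using \<open>t > 0\<close> by simp
        then show ?thesis using False by (simp add: k_def)
      qed
    qed
    also have "\<dots> = ennreal (t powr (- \<alpha>) * (\<integral>s. k t s \<partial>lborel))"
      using int_k k_nonneg by (subst nn_integral_eq_integral) auto
    finally have "P t = t powr (- \<alpha>) * (\<integral>s. k t s \<partial>lborel)"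
      using k_nonneg by (subst (asm) ennreal_inj) (auto simp: P_def)
    then show ?thesis using \<open>t > 0\<close> by (simp add: powr_minus)
  qed
  then have ev: "\<forall>\<^sub>F t in at_top. (\<integral>s. k t s \<partial>lborel) = t powr \<alpha> * P t"
    by (intro eventually_at_top_linorderI[of t0]) simp
  have "((\<lambda>t. \<integral>s. k t s \<partial>lborel) \<longlongrightarrow>
      (\<integral>s. K * (indicator {1<..} s * s powr (- \<alpha> - 1)) \<partial>lborel)) at_top"
  proof (rule integral_dominated_convergence_at_top[OF _ _ int_D])
    show "\<forall>\<^sub>F t in at_top. AE s in lborel. norm (k t s) \<le> D s"
      using bound by (auto simp: eventually_at_top_linorder)
    have "((\<lambda>t. k t s) \<longlongrightarrow> K * (indicator {1<..} s * s powr (- \<alpha> - 1))) at_top" for s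
    proof (cases "s > 1")
      case True
      then have "filterlim (\<lambda>t. t * s) at_top at_top"
        by (intro filterlim_at_top_mult_tendsto_pos[OF tendsto_const _ filterlim_ident]) auto
      from filterlim_compose[OF lim this]
      have "((\<lambda>t. s powr (- \<alpha> - 1) * h (t * s)) \<longlongrightarrow> s powr (- \<alpha> - 1) * K) at_top"
        unfolding h_def by (intro tendsto_mult_left) auto
      then show ?thesis using True by (simp add: k_def mult.commute)
    qed (simp add: k_def)
    then show "AE s in lborel.
        ((\<lambda>t. k t s) \<longlongrightarrow> K * (indicator {1<..} s * s powr (- \<alpha> - 1))) at_top"
      by simp
  qed (auto simp: k_def)
  then have "((\<lambda>t. t powr \<alpha> * P t) \<longlongrightarrow> K * (1 / \<alpha>)) at_top"
    using tail by (simp add: has_bochner_integral_iff tendsto_cong[OF ev])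
  then have P_lim: "((\<lambda>t. t powr \<alpha> * P t) \<longlongrightarrow> K / \<alpha>) at_top" by simp
  have "((\<lambda>t. \<P>(\<omega> in M. R \<omega> > t * x \<bar> R \<omega> > t)) \<longlongrightarrow> x powr (- \<alpha>)) at_top" if "x \<ge> 1" for x
  proof -
    have "filterlim (\<lambda>t. t * x) at_top at_top"
      using that by (intro filterlim_at_top_mult_tendsto_pos[OF tendsto_const _ filterlim_ident]) auto
    \<comment> \<open>Numerator and denominator have the same nonzero limit
      \<open>K / \<alpha>\<close>, so their quotient tends to 1; the factor
      \<open>x powr (- \<alpha>)\<close> compensates for \<open>(t * x) powr \<alpha>\<close>
      against \<open>t powr \<alpha>\<close>.\<close>
    from filterlim_compose[OF P_lim this]
    have "((\<lambda>t. x powr (- \<alpha>) * (((t * x) powr \<alpha> * P (t * x)) / (t powr \<alpha> * P t))) \<longlongrightarrow>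
        x powr (- \<alpha>) * ((K / \<alpha>) / (K / \<alpha>))) at_top"
      using \<open>\<alpha> > 0\<close> \<open>K > 0\<close> by (intro tendsto_mult_left tendsto_divide P_lim) auto
    moreover have "\<forall>\<^sub>F t in at_top. x powr (- \<alpha>) * (((t * x) powr \<alpha> * P (t * x)) / (t powr \<alpha> * P t))
        = \<P>(\<omega> in M. R \<omega> > t * x \<bar> R \<omega> > t)"
      using eventually_gt_at_top[of 0]
    proof eventually_elim
      case (elim t)
      then have "t \<le> t * x" using that by simp
      then have "(R \<omega> > t * x \<and> R \<omega> > t) = (R \<omega> > t * x)" for \<omega> by auto
      \<comment> \<open>If \<open>P t = 0\<close>, both sides of the identity to be shown are 0,
        since division by 0 yields 0.\<close>
      then have "\<P>(\<omega> in M. R \<omega> > t * x \<bar> R \<omega> > t) = P (t * x) / P t"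
        by (simp add: cond_prob_def P_def)
      then show ?case using elim that by (simp add: powr_mult powr_minus)
    qed
    ultimately show ?thesis
      using \<open>\<alpha> > 0\<close> \<open>K > 0\<close> by (simp add: tendsto_cong)
  qed
  then show ?thesis
    using \<open>\<alpha> > 0\<close> \<open>prob_space M\<close> by (simp add: heavy_tailed_def)
qed


section \<open>Asymptotics of the VAE output density\<close>

theorem proposition10:
  fixes M :: "'a measure" and R :: "'a \<Rightarrow> real"
    and \<alpha> a\<^sub>\<theta> c_inf c_zero :: real
    and \<alpha>\<^sub>\<theta> \<beta>\<^sub>\<theta> :: "real \<Rightarrow> real"
  assumes "\<alpha> > 0" and "a\<^sub>\<theta> > 0"
    and "\<And>z. z > 0 \<Longrightarrow> \<alpha>\<^sub>\<theta> z = a\<^sub>\<theta>"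
    and "\<And>z. z > 0 \<Longrightarrow> \<beta>\<^sub>\<theta> z > 0"
    and "continuous_on {0<..} \<beta>\<^sub>\<theta>"
    and "c_inf > 0" and "c_zero > 0"
    and "((\<lambda>z. z * \<beta>\<^sub>\<theta> z) \<longlongrightarrow> c_inf) at_top"
    and "((\<lambda>z. z * \<beta>\<^sub>\<theta> z) \<longlongrightarrow> c_zero) (at_right 0)"
    and "prob_space M"
    and "distributed M lborel R
           (vae_output_density (inv_gamma_density \<alpha> 1)
              (\<lambda>z. gamma_density (\<alpha>\<^sub>\<theta> z) (\<beta>\<^sub>\<theta> z)))"
  shows "heavy_tailed M R \<alpha>"
proof -
  let ?p = "vae_output_density (inv_gamma_density \<alpha> 1) (\<lambda>z. gamma_density (\<alpha>\<^sub>\<theta> z) (\<beta>\<^sub>\<theta> z))"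
  \<comment> \<open>Continuity is known only on the open half-line; cutting off by 0 gives a
    function that is Borel measurable on the whole line.\<close>
  define k where "k z = indicator {0<..} z * (z * \<beta>\<^sub>\<theta> z)" for z :: real
  define C where "C = 1 / (Gamma a\<^sub>\<theta> * Gamma \<alpha>)"
  \<comment> \<open>Here t is the output value and z = t w the latent one, with
    \<open>t powr (- \<alpha> - 1)\<close> factored out. The decoder exponent takes this form
    because z = t w turns \<open>\<beta>\<^sub>\<theta> z * t\<close> into
    \<open>k (t * w) / w\<close>. \<open>G\<close> is the pointwise limit as t grows.\<close>
  define F where "F t w = indicator {0<..} w * (C * k (t * w) powr a\<^sub>\<theta> *
    (w powr (- (a\<^sub>\<theta> + \<alpha>) - 1) * exp (- k (t * w) / w)) * exp (- 1 / (t * w)))" for t w :: real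
  define G where "G w = indicator {0<..} w * (C * c_inf powr a\<^sub>\<theta> *
    (w powr (- (a\<^sub>\<theta> + \<alpha>) - 1) * exp (- c_inf / w)))" for w :: real
  have "C > 0" using assms(1,2) by (simp add: C_def Gamma_real_pos)
  have cont: "continuous_on {0<..} (\<lambda>z. z * \<beta>\<^sub>\<theta> z)"
    by (intro continuous_intros assms(5))
  then have [measurable]: "k \<in> borel_measurable borel"
    using borel_measurable_continuous_on_indicator[OF _ cont] by (simp add: k_def[abs_def])
  have [measurable]: "F t \<in> borel_measurable borel" for t
    unfolding F_def by measurable
  have [measurable]: "G \<in> borel_measurable borel"
    unfolding G_def by measurable
  have F_nonneg: "0 \<le> F t w" for t w
    using \<open>C > 0\<close> by (simp add: F_def)
  \<comment> \<open>For fixed t the argument \<open>t * w\<close> runs through the whole half-line,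
    so a dominating function independent of t needs bounds on \<open>k\<close> down to 0. The limit
    \<open>c_zero\<close> supplies them there.\<close>
  obtain m B where "m > 0" and lower: "\<And>z. z > 0 \<Longrightarrow> m \<le> z * \<beta>\<^sub>\<theta> z"
    and upper: "\<And>z. z > 0 \<Longrightarrow> z * \<beta>\<^sub>\<theta> z \<le> B"
    using continuous_pos_limits_bounded[OF cont _ assms(6,7,8,9)] assms(4) by (metis mult_pos_pos)
  \<comment> \<open>The power of \<open>k\<close> is bounded through B and the decoder exponential
    through m, while the prior's factor \<open>exp (- 1 / (t * w))\<close> is at most 1.\<close>
  define D where "D w = C * B powr a\<^sub>\<theta> *
    (indicator {0<..} w * (w powr (- (a\<^sub>\<theta> + \<alpha>) - 1) * exp (- m / w)))" for w :: real
  have int_D: "integrable lborel D"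
    using integrable_inv_gamma_kernel[of "a\<^sub>\<theta> + \<alpha>" m] assms(1,2) \<open>m > 0\<close>
    unfolding D_def by (intro integrable_mult_right) simp
  have bound: "norm (F t w) \<le> D w" if "t > 0" for t w
  proof (cases "w > 0")
    case True
    then have "t * w > 0" using that by simp
    then have k: "m \<le> k (t * w)" "k (t * w) \<le> B"
      using lower upper by (simp_all add: k_def)
    then have "k (t * w) powr a\<^sub>\<theta> \<le> B powr a\<^sub>\<theta>"
      using assms(2) \<open>m > 0\<close> by (intro powr_mono2) auto
    \<comment> \<open>The trailing \<open>* 1\<close> bounds the prior's exponential, so that both
      products can be compared factor by factor.\<close>
    then have "F t w \<le> (C * B powr a\<^sub>\<theta> * (w powr (- (a\<^sub>\<theta> + \<alpha>) - 1) * exp (- m / w))) * 1"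
      using True \<open>C > 0\<close> \<open>m > 0\<close> \<open>t * w > 0\<close> k unfolding F_def
      by (simp only: indicator_simps greaterThan_iff mult_1_left if_True)
        (intro mult_mono order_refl, auto intro!: divide_right_mono)
    then show ?thesis using True F_nonneg[of t w] by (simp add: D_def)
  qed (simp add: F_def D_def)
  have int_F: "integrable lborel (F t)" if "t > 0" for t
    using bound[OF that] by (intro Bochner_Integration.integrable_bound[OF int_D])
      (auto intro!: AE_I2 order_trans[OF _ abs_ge_self])
  have density: "?p t = ennreal (t powr (- \<alpha> - 1) * (\<integral>w. F t w \<partial>lborel))" if "t > 0" for t
  proof -
    \<comment> \<open>The integrand is first written as a function of \<open>z / t\<close>, so that
      the substitution z = t w yields \<open>F t w\<close> directly; the division by t cancels the
      Jacobian.\<close>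
    have "?p t = (\<integral>\<^sup>+z. ennreal (t powr (- \<alpha> - 1) / t * F t (z / t)) \<partial>lborel)"
      unfolding vae_output_density_def
    proof (intro nn_integral_cong)
      fix z :: real
      show "ennreal (gamma_density (\<alpha>\<^sub>\<theta> z) (\<beta>\<^sub>\<theta> z) t * inv_gamma_density \<alpha> 1 z) * indicator {0<..} z
          = ennreal (t powr (- \<alpha> - 1) / t * F t (z / t))"
      proof (cases "z > 0")
        case True
        \<comment> \<open>\<open>E\<close> collects the Gamma constants and both exponentials,
          leaving only powers to be rearranged.\<close>
        define E where "E = C * exp (- \<beta>\<^sub>\<theta> z * t) * exp (- 1 / z)"
        \<comment> \<open>These two identities match the powers of z and t in the product of the
          densities with those coming from the powers of \<open>z * \<beta>\<^sub>\<theta> z\<close>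
          and of \<open>z / t\<close> in \<open>F t (z / t)\<close>.\<close>
        have z: "z powr a\<^sub>\<theta> * z powr (- (a\<^sub>\<theta> + \<alpha>) - 1) = z powr (- \<alpha> - 1)"
          by (simp flip: powr_add)
        have t: "t powr (- \<alpha> - 1) / t / t powr (- (a\<^sub>\<theta> + \<alpha>) - 1) = t powr (a\<^sub>\<theta> - 1)"
          using that by (simp add: powr_diff powr_add powr_minus field_simps)
        have "gamma_density (\<alpha>\<^sub>\<theta> z) (\<beta>\<^sub>\<theta> z) t * inv_gamma_density \<alpha> 1 z
            = \<beta>\<^sub>\<theta> z powr a\<^sub>\<theta> * t powr (a\<^sub>\<theta> - 1) * z powr (- \<alpha> - 1) * E"
          using True that assms(3)[OF True]
          by (simp add: gamma_density_def inv_gamma_density_def C_def E_def)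
        also have "\<dots> = t powr (- \<alpha> - 1) / t *
            ((z * \<beta>\<^sub>\<theta> z) powr a\<^sub>\<theta> * (z / t) powr (- (a\<^sub>\<theta> + \<alpha>) - 1)) * E"
          unfolding t[symmetric] z[symmetric] using True that assms(4)[OF True]
          by (simp add: powr_mult powr_divide)
        also have "\<dots> = t powr (- \<alpha> - 1) / t * F t (z / t)"
          using True that by (simp add: F_def k_def E_def mult.commute)
        finally show ?thesis using True by simp
      qed (use that in \<open>simp add: F_def zero_less_divide_iff\<close>)
    qed
    also have "\<dots> = ennreal t * (\<integral>\<^sup>+w. ennreal (t powr (- \<alpha> - 1) / t * F t w) \<partial>lborel)"
      using that by (subst nn_integral_real_affine[where c = t and t = 0]) auto
    also have "\<dots> = ennreal t * ennreal (t powr (- \<alpha> - 1) / t * (\<integral>w. F t w \<partial>lborel))"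
      using int_F[OF that] F_nonneg that by (subst nn_integral_eq_integral) auto
    also have "\<dots> = ennreal (t powr (- \<alpha> - 1) * (\<integral>w. F t w \<partial>lborel))"
      using that by (simp flip: ennreal_mult')
    finally show ?thesis .
  qed
  have F_lim: "((\<lambda>t. F t w) \<longlongrightarrow> G w) at_top" for w
  proof (cases "w > 0")
    case True
    then have tw: "filterlim (\<lambda>t. t * w) at_top at_top"
      by (intro filterlim_at_top_mult_tendsto_pos[OF tendsto_const _ filterlim_ident]) auto
    have "\<forall>\<^sub>F z in at_top. z * \<beta>\<^sub>\<theta> z = k z"
      using eventually_gt_at_top[of 0] by eventually_elim (simp add: k_def)
    from Lim_transform_eventually[OF assms(8) this]
    have k: "((\<lambda>t. k (t * w)) \<longlongrightarrow> c_inf) at_top"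
      using filterlim_compose tw by blast
    \<comment> \<open>The prior's exponential tends to 1, so only the power factor of the prior
      survives in the limit.\<close>
    have "((\<lambda>t. - 1 / (t * w)) \<longlongrightarrow> 0) at_top"
      using tw by (intro real_tendsto_divide_at_top[OF tendsto_const])
    then have "((\<lambda>t. C * k (t * w) powr a\<^sub>\<theta> * (w powr (- (a\<^sub>\<theta> + \<alpha>) - 1) * exp (- k (t * w) / w)) *
        exp (- 1 / (t * w))) \<longlongrightarrow> C * c_inf powr a\<^sub>\<theta> * (w powr (- (a\<^sub>\<theta> + \<alpha>) - 1) * exp (- c_inf / w)) * exp 0) at_top"
      using True \<open>c_inf > 0\<close> by (intro tendsto_intros k) auto
    then show ?thesis using True by (simp add: F_def G_def)
  qed (simp add: F_def G_def)
  have bound_ev: "\<forall>\<^sub>F t in at_top. AE w in lborel. norm (F t w) \<le> D w"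
    using eventually_gt_at_top[of 0] by eventually_elim (intro AE_I2 bound)
  have lim: "((\<lambda>t. \<integral>w. F t w \<partial>lborel) \<longlongrightarrow> (\<integral>w. G w \<partial>lborel)) at_top"
    by (rule integral_dominated_convergence_at_top[OF _ _ int_D _ bound_ev]) (auto simp: F_lim)
  have int_G: "integrable lborel G"
    by (rule integrable_dominated_convergence_at_top[OF _ _ int_D _ bound_ev]) (auto simp: F_lim)
  have G_nonneg: "0 \<le> G w" for w using \<open>C > 0\<close> by (simp add: G_def)
  \<comment> \<open>\<open>G\<close> is strictly positive on the half-line, so a vanishing integral
    would make the unit interval a null set.\<close>
  have "(\<integral>w. G w \<partial>lborel) \<noteq> 0"
  proof
    assume "(\<integral>w. G w \<partial>lborel) = 0"
    then have "AE w in lborel. G w = 0"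
      using integral_nonneg_eq_0_iff_AE[OF int_G] G_nonneg by simp
    then have "AE w in lborel. w \<notin> {0<..<1::real}"
      using \<open>C > 0\<close> \<open>c_inf > 0\<close> by (auto elim!: eventually_mono simp: G_def)
    then have "emeasure lborel {0<..<1::real} = 0"
      by (subst (asm) AE_iff_measurable[where N = "{0<..<1}"]) auto
    then show False by simp
  qed
  then have K: "(\<integral>w. G w \<partial>lborel) > 0"
    using Bochner_Integration.integral_nonneg[OF G_nonneg] by (simp add: order_less_le)
  show ?thesis
  proof (rule heavy_tailed_of_density_asymptotic[OF assms(10,11,1) K])
    show "\<forall>\<^sub>F r in at_top. ?p r < \<top>"
      using eventually_gt_at_top[of 0] by eventually_elim (simp add: density)
    have "\<forall>\<^sub>F r in at_top. (\<integral>w. F r w \<partial>lborel) = r powr (\<alpha> + 1) * enn2real (?p r)"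
      using eventually_gt_at_top[of 0]
    proof eventually_elim
      case (elim r)
      have "r powr (\<alpha> + 1) * r powr (- \<alpha> - 1) = 1"
        using elim by (simp flip: powr_add)
      moreover have "0 \<le> (\<integral>w. F r w \<partial>lborel)"
        using F_nonneg by (intro Bochner_Integration.integral_nonneg)
      ultimately show ?case
        using elim by (simp add: density flip: mult.assoc)
    qed
    from Lim_transform_eventually[OF lim this]
    show "((\<lambda>r. r powr (\<alpha> + 1) * enn2real (?p r)) \<longlongrightarrow> (\<integral>w. G w \<partial>lborel)) at_top" .
  qed
qed

end
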